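(* Let $H$ be a graph of order $n'$. If $H\not\cong N_{n'}$ and $H\not\cong K_{n'}$, then for any integer $n\ge 1$, $$\gamma_{\rm sp}(K_n+H)=n+\gamma_{\rm sp}(H).$$
   Context: All graphs are finite, simple and undirected, with nonempty vertex set; the order of a graph is its number of vertices. $K_m$ and $N_m$ are the complete graph and the empty (edgeless) graph of order $m$. For a vertex $v$ of $G$, $N(v)$ is the set of vertices adjacent to $v$, and for $D\subseteq V(G)$, $\overline{D}=V(G)\setminus D$. A set $D\subseteq V(G)$ is a super dominating set of $G$ if for every $u\in\overline{D}$ there exists $v\in D$ such that $N(v)\cap\overline{D}=\{u\}$. The super domination number $\gamma_{\rm sp}(G)$ is the minimum cardinality of a super dominating set of $G$. The join $G+H$ is the graph obtained from disjoint copies of $G$ and $H$ by joining by an edge each vertex of $G$ with each vertex of $H$. *)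

theory Defs
  imports "Graph_Theory.Graph_Theory"
begin

(* An undirected simple graph is a pair_graph: finite, loopless, with a symmetric set of
   ordered pairs as arcs.  Only nonemptiness of the vertex set is missing there. *)
locale simple_graph = pair_graph G for G :: "'a pair_pre_digraph" +
  assumes verts_nonempty: "pverts G \<noteq> {}"

definition graph_iso :: "'a pair_pre_digraph \<Rightarrow> 'b pair_pre_digraph \<Rightarrow> bool" where
  "graph_iso G H \<longleftrightarrow> digraph_iso (with_proj G) (with_proj H)"

definition complete_graph :: "nat \<Rightarrow> nat pair_pre_digraph" where
  "complete_graph m = \<lparr>pverts = {..<m}, parcs = {(u, v). u < m \<and> v < m \<and> u \<noteq> v}\<rparr>"

definition edgeless_graph :: "nat \<Rightarrow> nat pair_pre_digraph" where
  "edgeless_graph m = \<lparr>pverts = {..<m}, parcs = {}\<rparr>"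

(* The sum type supplies the disjoint copies. *)
definition graph_join ::
    "'a pair_pre_digraph \<Rightarrow> 'b pair_pre_digraph \<Rightarrow> ('a + 'b) pair_pre_digraph" where
  "graph_join G H = \<lparr>
     pverts = pverts G <+> pverts H,
     parcs = {(Inl u, Inl v) | u v. (u, v) \<in> parcs G}
           \<union> {(Inr u, Inr v) | u v. (u, v) \<in> parcs H}
           \<union> {(Inl u, Inr v) | u v. u \<in> pverts G \<and> v \<in> pverts H}
           \<union> {(Inr v, Inl u) | u v. u \<in> pverts G \<and> v \<in> pverts H}\<rparr>"

definition neighborhood :: "'a pair_pre_digraph \<Rightarrow> 'a \<Rightarrow> 'a set" where
  "neighborhood G v = {w. (v, w) \<in> parcs G}"

definition super_dominating :: "'a pair_pre_digraph \<Rightarrow> 'a set \<Rightarrow> bool" where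
  "super_dominating G D \<longleftrightarrow> D \<subseteq> pverts G \<and>
     (\<forall>u \<in> pverts G - D. \<exists>v \<in> D. neighborhood G v \<inter> (pverts G - D) = {u})"

definition super_domination_number :: "'a pair_pre_digraph \<Rightarrow> nat" where
  "super_domination_number G = Min (card ` {D. super_dominating G D})"

lemma simple_graphI:
  assumes "finite (pverts G)" "pverts G \<noteq> {}" "parcs G \<subseteq> pverts G \<times> pverts G"
    and "\<And>u v. (u, v) \<in> parcs G \<Longrightarrow> (v, u) \<in> parcs G" "\<And>v. (v, v) \<notin> parcs G"
  shows "simple_graph G"
proof -
  have "finite (parcs G)"
    using assms(1,3) by (meson finite_SigmaI finite_subset)
  then show ?thesis
    using assms by unfold_locales (auto simp: symmetric_def intro: symI)
qed

lemma simple_graph_complete: "m \<ge> 1 \<Longrightarrow> simple_graph (complete_graph m)"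
  by (rule simple_graphI) (auto simp: complete_graph_def lessThan_empty_iff)

lemma complete_digraph_complete_graph: "complete_digraph m (with_proj (complete_graph m))"
  by (auto simp: complete_digraph_pair_def complete_graph_def)

lemma simple_graph_edgeless: "m \<ge> 1 \<Longrightarrow> simple_graph (edgeless_graph m)"
  by (rule simple_graphI) (auto simp: edgeless_graph_def lessThan_empty_iff)

lemma simple_graph_join:
  assumes "simple_graph G" "simple_graph H"
  shows "simple_graph (graph_join G H)"
proof -
  interpret G: simple_graph G by fact
  interpret H: simple_graph H by fact
  show ?thesis
    using G.verts_nonempty G.pair_finite_verts H.pair_finite_verts
    by (intro simple_graphI)
      (auto simp: graph_join_def dest: G.in_arcsD1 G.in_arcsD2 H.in_arcsD1 H.in_arcsD2
        G.no_loops' H.no_loops' intro: G.arcs_symmetric H.arcs_symmetric)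
qed

(* The minimum defining super_domination_number is over a finite nonempty set. *)
lemma super_dominating_sets:
  assumes "simple_graph G"
  shows "finite {D. super_dominating G D}" "super_dominating G (pverts G)"
proof -
  interpret simple_graph G by fact
  have "{D. super_dominating G D} \<subseteq> Pow (pverts G)"
    by (auto simp: super_dominating_def)
  then show "finite {D. super_dominating G D}"
    using pair_finite_verts by (simp add: finite_subset)
  show "super_dominating G (pverts G)"
    by (auto simp: super_dominating_def)
qed

end

theory Submission
  imports Defs
begin

text \<open>
  Everything is phrased through the complement \<open>C\<close> of a super dominating set: each \<open>u \<in> C\<close> needs
  a dominator outside \<open>C\<close> whose only neighbour in \<open>C\<close> is \<open>u\<close>.  The claim says that the
  largest such complement has the same size in \<open>K\<^sub>n + H\<close> as in \<open>H\<close>.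

  A complement in \<open>H\<close> remains one in the join, because there the old dominators gain neighbours only
  in \<open>K\<^sub>n\<close>, which avoids the complement.  Conversely, a vertex \<open>k\<close> of \<open>K\<^sub>n\<close> is adjacent to all other
  vertices of the join.  If \<open>k\<close> lies in \<open>C\<close>, then every dominator sees \<open>k\<close>, so \<open>C = {k}\<close>; if \<open>k\<close> is
  a dominator, it sees all of \<open>C\<close>, so again \<open>C\<close> is a singleton.  Hence either \<open>C\<close> lies in \<open>H\<close> with
  all dominators in \<open>H\<close>, so that \<open>C\<close> is a complement in \<open>H\<close>, or \<open>C\<close> has at most one
  element.  A complement of size one exists in \<open>H\<close> as well: as \<open>H\<close> is not edgeless it has
  an edge, and either end of that edge super dominates the other.
\<close>

lemma super_domination_number_le:
  assumes "simple_graph G" "super_dominating G D"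
  shows "super_domination_number G \<le> card D"
  using assms super_dominating_sets(1)[OF assms(1)]
  by (auto simp: super_domination_number_def intro!: Min_le)

lemma super_domination_number_attained:
  assumes "simple_graph G"
  obtains D where "super_dominating G D" "card D = super_domination_number G"
proof -
  have "super_domination_number G \<in> card ` {D. super_dominating G D}"
    using super_dominating_sets[OF assms]
    unfolding super_domination_number_def by (intro Min_in) auto
  then show thesis
    using that by auto
qed

lemma graph_iso_edgeless:
  assumes "finite (pverts H)" "parcs H = {}"
  shows "graph_iso H (edgeless_graph (card (pverts H)))"
proof -
  obtain h where h: "bij_betw h (pverts H) {..<card (pverts H)}"
    using assms(1) by (metis ex_bij_betw_finite_nat lessThan_atLeast0)
  \<comment> \<open>With no arcs at all, only the vertex map of the isomorphism matters.\<close>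
  let ?h = "\<lparr>iso_verts = h, iso_arcs = map_prod h h, iso_head = snd, iso_tail = fst\<rparr>"
  have "wf_digraph (with_proj H)"
    using assms(2) by unfold_locales auto
  then have "pre_digraph.digraph_isomorphism (with_proj H) ?h"
    using h assms(2) by (auto simp: pre_digraph.digraph_isomorphism_def bij_betw_def)
  moreover have "app_iso ?h (with_proj H) = with_proj (edgeless_graph (card (pverts H)))"
    using h assms(2) by (auto simp: app_iso_def edgeless_graph_def bij_betw_def with_proj_def)
  ultimately show ?thesis
    by (auto simp: graph_iso_def digraph_iso_def)
qed

lemma super_dominating_remove_vertex:
  assumes "simple_graph H" "(u, v) \<in> parcs H"
  shows "super_dominating H (pverts H - {v})"
proof -
  interpret simple_graph H by fact
  have "u \<in> pverts H - {v}" "v \<in> pverts H"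
    using assms(2) no_loops' by (auto dest: in_arcsD1 in_arcsD2)
  with assms(2) show ?thesis
    by (auto simp: super_dominating_def neighborhood_def intro!: bexI[of _ u])
qed

lemma super_domination_number_less_order:
  assumes "simple_graph H" "(u, v) \<in> parcs H"
  shows "super_domination_number H < card (pverts H)"
proof -
  interpret simple_graph H by fact
  have "super_domination_number H \<le> card (pverts H - {v})"
    by (intro super_domination_number_le super_dominating_remove_vertex[OF assms] assms(1))
  also have "\<dots> < card (pverts H)"
    using assms(2) by (intro card_Diff1_less) (auto dest: in_arcsD2)
  finally show ?thesis .
qed

lemma pverts_graph_join [simp]: "pverts (graph_join G H) = pverts G <+> pverts H"
  by (simp add: graph_join_def)

lemma neighborhood_graph_join_Inr_Int:
  "neighborhood (graph_join G H) (Inr v) \<inter> Inr ` C = Inr ` (neighborhood H v \<inter> C)"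
  by (auto simp: neighborhood_def graph_join_def)

text \<open>
  The new neighbours in \<open>G\<close> do not spoil the private neighbour of a dominator from \<open>H\<close>, since all
  of \<open>G\<close> is put outside the complement.
\<close>

lemma super_dominating_join:
  assumes "super_dominating H D"
  shows "super_dominating (graph_join G H) (pverts G <+> D)"
proof -
  have compl: "(pverts G <+> pverts H) - (pverts G <+> D) = Inr ` (pverts H - D)"
    by auto
  have "\<exists>v \<in> pverts G <+> D. neighborhood (graph_join G H) v \<inter> Inr ` (pverts H - D) = {Inr u}"
    if u: "u \<in> pverts H - D" for u
  proof -
    obtain v where v: "v \<in> D" "neighborhood H v \<inter> (pverts H - D) = {u}"
      using u assms unfolding super_dominating_def by blast
    then show ?thesis
      by (intro bexI[of _ "Inr v"]) (auto simp: neighborhood_graph_join_Inr_Int)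
  qed
  then show ?thesis
    using assms unfolding super_dominating_def pverts_graph_join compl by auto
qed

text \<open>
  A vertex adjacent to all others forces the complement to be a singleton as soon as it takes part in
  the domination: inside the complement it is a second neighbour for every dominator of another
  vertex; as a dominator it has the entire complement among its neighbours.
\<close>

lemma universal_vertex_in_complement:
  assumes "simple_graph G" "super_dominating G D" "k \<in> pverts G - D"
    and "pverts G - {k} \<subseteq> neighborhood G k"
  shows "pverts G - D = {k}"
proof -
  interpret simple_graph G by fact
  have "u = k" if u: "u \<in> pverts G - D" for u
  proof -
    obtain v where v: "v \<in> D" "neighborhood G v \<inter> (pverts G - D) = {u}"
      using u assms(2) unfolding super_dominating_def by blast
    have "v \<in> neighborhood G k"
      using v(1) assms(2-4) by (auto simp: super_dominating_def)
    then have "k \<in> neighborhood G v"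
      by (auto simp: neighborhood_def intro: arcs_symmetric)
    with v(2) assms(3) show ?thesis by auto
  qed
  with assms(3) show ?thesis by blast
qed

lemma universal_vertex_as_dominator:
  assumes "D \<subseteq> pverts G" "k \<in> D"
    and "pverts G - {k} \<subseteq> neighborhood G k"
    and "neighborhood G k \<inter> (pverts G - D) = {u}"
  shows "pverts G - D = {u}"
  using assms by auto

lemma universal_vertex_join_complete:
  assumes "k < n"
  shows "pverts (graph_join (complete_graph n) H) - {Inl k}
           \<subseteq> neighborhood (graph_join (complete_graph n) H) (Inl k)"
  using assms by (auto simp: neighborhood_def graph_join_def complete_graph_def)

text \<open>
  Once two vertices lie outside \<open>D\<close>, every vertex of \<open>K\<^sub>n\<close>, being adjacent to all others, is in \<open>D\<close>
  but dominates nothing, so the part of \<open>D\<close> in \<open>H\<close> does all the work by itself.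
\<close>

lemma super_dominating_join_complete_cases:
  assumes "simple_graph H" "n \<ge> 1" "super_dominating (graph_join (complete_graph n) H) D"
  obtains (small) "card (pverts (graph_join (complete_graph n) H) - D) \<le> 1"
  | (restricts) D' where "super_dominating H D'" "D = pverts (complete_graph n) <+> D'"
proof (cases "card (pverts (graph_join (complete_graph n) H) - D) \<le> 1")
  case False
  let ?J = "graph_join (complete_graph n) H"
  interpret J: simple_graph ?J
    using assms by (intro simple_graph_join simple_graph_complete)
  have D: "D \<subseteq> pverts ?J"
    using assms(3) by (simp add: super_dominating_def)
  have K: "pverts (complete_graph n) = {..<n}"
    by (simp add: complete_graph_def)
  have "Inl k \<in> D" if "k < n" for k
  proof (rule ccontr)
    assume "Inl k \<notin> D"
    with that have "pverts ?J - D = {Inl k}"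
      using assms(3)
      by (intro universal_vertex_in_complement universal_vertex_join_complete J.simple_graph_axioms)
        (auto simp: K)
    with False show False by simp
  qed
  then have D_eq: "D = pverts (complete_graph n) <+> (Inr -` D)"
    using D by (auto simp: K)
  have compl: "pverts ?J - D = Inr ` (pverts H - Inr -` D)"
    by (subst D_eq) auto
  have "\<exists>v \<in> Inr -` D. neighborhood H v \<inter> (pverts H - Inr -` D) = {u}"
    if u: "u \<in> pverts H - Inr -` D" for u
  proof -
    obtain w where w: "w \<in> D" "neighborhood ?J w \<inter> (pverts ?J - D) = {Inr u}"
      using u assms(3) unfolding super_dominating_def compl by blast
    show ?thesis
    proof (cases w)
      case (Inl k)
      with D w(1) have "k < n"
        by (auto simp: K)
      from universal_vertex_as_dominator[OF D _ universal_vertex_join_complete[OF this]]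
      have "pverts ?J - D = {Inr u}"
        using w Inl by blast
      with False show ?thesis by simp
    next
      case (Inr v)
      have "Inr ` (neighborhood H v \<inter> (pverts H - Inr -` D)) = {Inr u :: nat + 'a}"
        using w(2) unfolding Inr compl neighborhood_graph_join_Inr_Int .
      then have "neighborhood H v \<inter> (pverts H - Inr -` D) = {u}"
        by (metis inj_Inr image_empty image_insert inj_image_eq_iff)
      with w(1) Inr show ?thesis by auto
    qed
  qed
  then have "super_dominating H (Inr -` D)"
    using D by (auto simp: super_dominating_def)
  then show thesis
    using D_eq by (rule restricts)
qed

theorem theorem23:
  fixes H :: "'a pair_pre_digraph" and n n' :: nat
  assumes "simple_graph H"
    and "card (pverts H) = n'"
    and "\<not> graph_iso H (edgeless_graph n')"
    and "\<not> graph_iso H (complete_graph n')"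
    and "n \<ge> 1"
  shows "super_domination_number (graph_join (complete_graph n) H)
       = n + super_domination_number H"
proof (rule antisym)
  let ?J = "graph_join (complete_graph n) H"
  interpret H: simple_graph H by fact
  have J: "simple_graph ?J"
    using assms by (intro simple_graph_join simple_graph_complete)
  then interpret J: simple_graph ?J .
  have K: "finite (pverts (complete_graph n))" "card (pverts (complete_graph n)) = n"
    by (auto simp: complete_graph_def)
  have card_join: "card (pverts (complete_graph n) <+> D) = n + card D" if "D \<subseteq> pverts H" for D
    using K card_Plus finite_subset[OF that H.pair_finite_verts] by metis

  obtain D where D: "super_dominating H D" "card D = super_domination_number H"
    using super_domination_number_attained[OF assms(1)] .
  have "super_domination_number ?J \<le> card (pverts (complete_graph n) <+> D)"
    by (intro super_domination_number_le J super_dominating_join D)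
  with D show "super_domination_number ?J \<le> n + super_domination_number H"
    using card_join by (simp add: super_dominating_def)

  obtain D where D: "super_dominating ?J D" "card D = super_domination_number ?J"
    using super_domination_number_attained[OF J] .
  show "n + super_domination_number H \<le> super_domination_number ?J"
    using assms(1,5) D(1)
  proof (cases rule: super_dominating_join_complete_cases)
    case small
    obtain u v where "(u, v) \<in> parcs H"
      using graph_iso_edgeless[OF H.pair_finite_verts] assms(2,3) by fastforce
    then have "n + super_domination_number H < card (pverts ?J)"
      using super_domination_number_less_order[OF assms(1)] card_join by simp
    also have "card (pverts ?J) \<le> card D + 1"
      using small D(1) J.pair_finite_verts card_Diff_subset[of D "pverts ?J"]
      by (auto simp: super_dominating_def dest: finite_subset)
    finally show ?thesis
      using D(2) by simp
  next
    case (restricts D')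
    then show ?thesis
      using D(2) card_join[of D'] super_domination_number_le[OF assms(1), of D']
      by (simp add: super_dominating_def)
  qed
qed

end
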